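(* Let $K=\mathbb{Q}(\sqrt{d})$ be a real quadratic field with discriminant $d_{K}$. Then for every Pisot number $\zeta$ with $\mathbb{Q}(\zeta)=K$ (equivalently, every Pisot number $\zeta\in K\setminus\mathbb{Z}$) we have $1/\sqrt{d_{K}}\in\mathscr{M}_{\zeta}$. In particular $\mathcal{O}_{K}\subsetneq\bigcap_{\zeta\in S_{K}}\mathscr{M}_{\zeta}$.
   Context: A Pisot number is a real algebraic integer $\zeta>1$ all of whose conjugates other than $\zeta$ lie strictly inside the unit circle of $\mathbb{C}$; for a number field $K$, $S_{K}$ is the set of Pisot numbers $\zeta$ with $\mathbb{Q}(\zeta)=K$. For real $\zeta>1$, $\mathscr{M}_{\zeta}$ denotes the set of all $\alpha\in\mathbb{R}$ with $\Vert\alpha\zeta^{n}\Vert\to0$ as $n\to\infty$, where $\Vert x\Vert$ is the distance from $x$ to the nearest integer. $\mathcal{O}_{K}$ is the ring of integers of $K$ and $d_{K}$ is the discriminant of the number field $K$ (for square-free $d>1$: $d_{K}=d$ if $d\equiv1\bmod4$, $d_{K}=4d$ otherwise). *)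

theory Defs
  imports
    "HOL-Analysis.Analysis"
    "HOL-Computational_Algebra.Computational_Algebra"
    "Jordan_Normal_Form.Determinant"
begin

definition is_subfield :: "'a::field_char_0 set \<Rightarrow> bool" where
  "is_subfield F \<longleftrightarrow> 0 \<in> F \<and> 1 \<in> F \<and>
     (\<forall>x\<in>F. \<forall>y\<in>F. x - y \<in> F \<and> x * y \<in> F) \<and> (\<forall>x\<in>F. inverse x \<in> F)"

(* Q(x): every subfield of a field of characteristic 0 contains the rationals. *)
definition rat_adjoin :: "'a::field_char_0 \<Rightarrow> 'a set" where
  "rat_adjoin x = is_subfield hull {x}"

definition ring_of_integers :: "'a::field_char_0 set \<Rightarrow> 'a set" where
  "ring_of_integers K = {x \<in> K. algebraic_int x}"

definition is_min_poly :: "rat poly \<Rightarrow> 'a::field_char_0 \<Rightarrow> bool" where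
  "is_min_poly p x \<longleftrightarrow> lead_coeff p = 1 \<and> irreducible p \<and> poly (map_poly of_rat p) x = 0"

definition conjugate_of :: "complex \<Rightarrow> complex \<Rightarrow> bool" where
  "conjugate_of z x \<longleftrightarrow> (\<exists>p. is_min_poly p x \<and> poly (map_poly of_rat p) z = 0)"

definition pisot :: "real \<Rightarrow> bool" where
  "pisot \<zeta> \<longleftrightarrow> algebraic_int \<zeta> \<and> \<zeta> > 1 \<and>
     (\<forall>z. conjugate_of z (of_real \<zeta>) \<and> z \<noteq> of_real \<zeta> \<longrightarrow> norm z < 1)"

definition pisot_generators :: "real set \<Rightarrow> real set" where
  "pisot_generators K = {\<zeta>. pisot \<zeta> \<and> rat_adjoin \<zeta> = K}"

definition dist_nearest_int :: "real \<Rightarrow> real" where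
  "dist_nearest_int x = \<bar>x - of_int (round x)\<bar>"

definition M_set :: "real \<Rightarrow> real set" where
  "M_set \<zeta> = {\<alpha>. (\<lambda>n. dist_nearest_int (\<alpha> * \<zeta> ^ n)) \<longlonglongrightarrow> 0}"

(* Extensionality makes a map determined by its values on K, so that the sum in
   field_trace counts each embedding of K once. *)
definition embeddings :: "'a::field_char_0 set \<Rightarrow> ('a \<Rightarrow> complex) set" where
  "embeddings K = {\<sigma> \<in> extensional K. \<sigma> 1 = 1 \<and>
     (\<forall>x\<in>K. \<forall>y\<in>K. \<sigma> (x + y) = \<sigma> x + \<sigma> y \<and> \<sigma> (x * y) = \<sigma> x * \<sigma> y)}"

definition field_trace :: "'a::field_char_0 set \<Rightarrow> 'a \<Rightarrow> complex" where
  "field_trace K x = (\<Sum>\<sigma>\<in>embeddings K. \<sigma> x)"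

definition integral_basis :: "'a::field_char_0 set \<Rightarrow> 'a list \<Rightarrow> bool" where
  "integral_basis K bs \<longleftrightarrow> set bs \<subseteq> ring_of_integers K \<and>
     (\<forall>x\<in>ring_of_integers K. \<exists>!c :: int list. length c = length bs \<and>
        x = (\<Sum>i<length bs. of_int (c ! i) * bs ! i))"

(* For a number field K: the determinant of the trace form on an integral basis,
   which is an integer independent of the basis. *)
definition field_discriminant :: "'a::field_char_0 set \<Rightarrow> int" where
  "field_discriminant K = (THE D. \<exists>bs. integral_basis K bs \<and>
     of_int D = Determinant.det (Matrix.mat (length bs) (length bs)
       (\<lambda>(i, j). field_trace K (bs ! i * bs ! j))))"

end

(*
  Let D be the discriminant of K, omega = (D + sqrt D)/2, and write x' for the conjugate of x.
  The ring of integers is Z + Z omega, so zeta^n = u_n + v_n omega and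
  (zeta^n - zeta'^n) / sqrt D = v_n is an integer. As |zeta'| < 1, zeta^n / sqrt D tends to the
  integers, although 1 / sqrt D is not integral. In the same way, for integral alpha the trace
  alpha zeta^n + alpha' zeta'^n is an integer.
*)
theory Submission
  imports Defs "Jordan_Normal_Form.Char_Poly"
begin

text \<open>Both memberships are instances of one fact: if the trace alpha x + alpha' x' is an
  integer for every integral x, then x = zeta^n leaves only the error alpha' zeta'^n. Such alpha
  form the trace dual of the ring of integers. Integral alpha belong to it; so does 1 / sqrt D,
  whose conjugate is - 1 / sqrt D and whose trace form reads off the omega-coordinate v. The bulk of
  the work comes from the abstract notions. \<open>field_discriminant\<close> is a definite
  description over integral bases of unspecified length, with traces summed over embeddings, so the
  embeddings of K must be classified and every integral basis compared with 1, omega.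
  \<open>pisot\<close> speaks of roots of a minimal polynomial, so irreducibility of the quadratic
  of zeta has to be known before |zeta'| < 1 is available. That no integral elements lie outside Z +
  Z omega rests on Gauss's lemma and on squarefreeness of d.\<close>

section \<open>Subfields, generated fields and embeddings\<close>

lemma of_rat_in_subfield:
  assumes "is_subfield F"
  shows "of_rat r \<in> F"
proof -
  have sub: "x - y \<in> F" if "x \<in> F" "y \<in> F" for x y
    using assms that by (auto simp: is_subfield_def)
  have zero: "0 \<in> F" and one: "1 \<in> F"
    using assms by (auto simp: is_subfield_def)
  have uminus: "- x \<in> F" if "x \<in> F" for x
    using sub[OF zero that] by simp
  have plus: "x + y \<in> F" if "x \<in> F" "y \<in> F" for x y
    using sub[OF that(1) uminus[OF that(2)]] by simp
  have nat: "of_nat n \<in> F" for n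
    by (induction n) (auto intro: zero one plus)
  have int: "of_int k \<in> F" for k
    by (cases k) (auto intro: nat uminus simp del: of_nat_Suc)
  obtain a b where "r = of_int a / of_int b"
    by (cases r) (auto simp: Fract_of_int_quotient)
  then have "of_rat r = of_int a * inverse (of_int b :: 'a)"
    by (simp add: of_rat_divide field_simps)
  moreover have "of_int a * inverse (of_int b :: 'a) \<in> F"
    using assms int by (auto simp: is_subfield_def)
  ultimately show ?thesis by simp
qed

lemma subfield_add:
  assumes "is_subfield F" "x \<in> F" "y \<in> F"
  shows "x + y \<in> F"
proof -
  have "0 - y \<in> F"
    using assms unfolding is_subfield_def by blast
  then have "x - (0 - y) \<in> F"
    using assms unfolding is_subfield_def by blast
  then show ?thesis by simp
qed

lemma is_subfield_rat_adjoin: "is_subfield (rat_adjoin x)"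
  unfolding rat_adjoin_def by (rule hull_in) (auto simp: is_subfield_def)

lemma rat_adjoin_self: "x \<in> rat_adjoin x"
  unfolding rat_adjoin_def by (rule hull_inc) simp

lemma rat_adjoin_minimal: "is_subfield F \<Longrightarrow> x \<in> F \<Longrightarrow> rat_adjoin x \<subseteq> F"
  unfolding rat_adjoin_def by (rule hull_minimal) auto

lemma embedding_of_rat:
  assumes F: "is_subfield F" and \<sigma>: "\<sigma> \<in> embeddings F"
  shows "\<sigma> (of_rat r) = of_rat r"
proof -
  have add: "\<sigma> (x + y) = \<sigma> x + \<sigma> y" and mult: "\<sigma> (x * y) = \<sigma> x * \<sigma> y"
    if "x \<in> F" "y \<in> F" for x y
    using \<sigma> that by (auto simp: embeddings_def)
  have one: "\<sigma> 1 = 1"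
    using \<sigma> by (auto simp: embeddings_def)
  have rat: "of_rat q \<in> F" for q
    by (rule of_rat_in_subfield[OF F])
  have intF: "of_int k \<in> F" for k
    using rat[of "of_int k"] by simp
  have natF: "of_nat k \<in> F" for k
    using intF[of "int k"] by simp
  have zero: "\<sigma> 0 = 0"
    using add[of 0 0] natF[of 0] by simp
  have nat: "\<sigma> (of_nat n) = of_nat n" for n
  proof (induction n)
    case (Suc n)
    then show ?case using add[OF natF[of 1] natF[of n]] one by simp
  qed (simp add: zero)
  have int: "\<sigma> (of_int k) = of_int k" for k
  proof (cases "k \<ge> 0")
    case True
    then show ?thesis using nat[of "nat k"] by simp
  next
    case False
    have "\<sigma> (of_int k) + \<sigma> (of_nat (nat (- k))) = 0"
      unfolding add[OF intF[of k] natF[of "nat (- k)"], symmetric] using zero False by simp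
    then show ?thesis unfolding nat using False
      by (simp add: eq_neg_iff_add_eq_0)
  qed
  obtain a b where r: "r = of_int a / of_int b" and b: "b > 0"
    by (cases r) (auto simp: Fract_of_int_quotient)
  have "\<sigma> (of_rat r * of_int b) = \<sigma> (of_int a)"
    using r b by (simp add: of_rat_divide)
  then have "\<sigma> (of_rat r) * of_int b = of_int a"
    using mult[OF rat intF] int by simp
  then have "\<sigma> (of_rat r) = of_int a / of_int b"
    using b by (simp add: field_simps)
  also have "\<dots> = of_rat r"
    by (simp add: r of_rat_divide)
  finally show ?thesis .
qed

section \<open>Monic integer quadratics\<close>

lemma clear_denominators:
  fixes f :: "rat poly"
  obtains a F where "a > 0" "Polynomial.smult (of_int a) f = map_poly of_int F"
proof -
  have "\<exists>a F. a > 0 \<and> Polynomial.smult (of_int a) f = map_poly of_int F"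
  proof (induction f)
    case 0
    show ?case by (intro exI[of _ 1] exI[of _ 0]) simp
  next
    case (pCons c f)
    then obtain a F where aF: "a > 0" "Polynomial.smult (of_int a) f = map_poly of_int F"
      by blast
    obtain m n where c: "c = of_int m / of_int n" "n > 0"
      by (cases c) (auto simp: Fract_of_int_quotient)
    have "Polynomial.smult (of_int (n * a)) (pCons c f) = map_poly of_int (pCons (a * m) (Polynomial.smult n F))"
      using c aF by (simp add: of_int_hom.map_poly_pCons_hom map_poly_smult flip: smult_smult)
    then show ?case using aF c by (meson mult_pos_pos)
  qed
  then show thesis using that by blast
qed

text \<open>Gauss's lemma by multiplicativity of content. P is monic, hence has content 1, so the
  cleared factors F and G satisfy content F * content G = a * b. Their leading coefficients are a
  and b, so content F divides a and content G divides b; both divisibilities must be equalities, and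
  a divides every coefficient of F.\<close>

lemma gauss_monic_factor:
  fixes f g :: "rat poly"
  assumes "lead_coeff f = 1" "lead_coeff g = 1" "f * g = map_poly of_int P"
  shows "coeff f i \<in> \<int>"
proof -
  obtain a F where a: "a > 0" "Polynomial.smult (of_int a) f = map_poly of_int F"
    by (rule clear_denominators)
  obtain b G where b: "b > 0" "Polynomial.smult (of_int b) g = map_poly of_int G"
    by (rule clear_denominators)
  have cF: "of_int a * coeff f k = of_int (coeff F k)" for k
    using arg_cong[OF a(2), of "\<lambda>p. coeff p k"] by (simp add: coeff_map_poly)
  have cG: "of_int b * coeff g k = of_int (coeff G k)" for k
    using arg_cong[OF b(2), of "\<lambda>p. coeff p k"] by (simp add: coeff_map_poly)
  have cP: "coeff (f * g) k = of_int (coeff P k)" for k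
    using assms(3) by (simp add: coeff_map_poly)
  have "map_poly of_int (F * G) = (map_poly of_int (Polynomial.smult (a * b) P) :: rat poly)"
    by (simp add: of_int_poly_hom.hom_mult map_poly_smult assms(3)[symmetric] 
        a(2)[symmetric] b(2)[symmetric] mult_ac)
  then have FG: "F * G = Polynomial.smult (a * b) P"
    by simp
  have "lead_coeff (f * g) = 1"
    using assms(1,2) by (simp add: lead_coeff_mult)
  then have "coeff P (degree (f * g)) = 1"
    by (metis cP of_int_eq_1_iff)
  then have "content P dvd 1"
    by (metis content_dvd_coeff)
  then have "content P = 1"
    by (metis normalize_content is_unit_normalize)
  then have prod: "content F * content G = a * b"
    using arg_cong[OF FG, of content] a(1) b(1) by (simp add: content_mult normalize_mult)
  have "coeff F (degree f) = a" "coeff G (degree g) = b"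
    using cF[of "degree f"] cG[of "degree g"] assms(1,2) by simp_all
  then have dvd: "content F dvd a" "content G dvd b"
    by (metis content_dvd_coeff)+
  have "a dvd content F"
  proof -
    obtain k where k: "b = content G * k" using dvd by auto
    have "content G \<noteq> 0" using k b by auto
    then have "content F = a * k" using prod k by (simp add: mult_ac)
    then show ?thesis by simp
  qed
  then have "a dvd coeff F i"
    using content_dvd_coeff dvd_trans by blast
  then obtain k where "coeff F i = a * k" by auto
  then have "coeff f i = of_int k"
    using cF[of i] a(1) by simp
  then show ?thesis by simp
qed

lemma map_poly_of_rat_add:
  "map_poly of_rat (p + q) = (map_poly of_rat p + map_poly of_rat q :: 'a::field_char_0 poly)"
  by (rule poly_eqI) (simp add: coeff_map_poly of_rat_add)

lemma map_poly_of_rat_mult: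
  "map_poly of_rat (p * q) = (map_poly of_rat p * map_poly of_rat q :: 'a::field_char_0 poly)"
  by (rule poly_eqI) (simp add: coeff_map_poly coeff_mult of_rat_sum of_rat_mult)

lemma of_real_of_rat: "of_real (of_rat r) = (of_rat r :: 'a::{real_div_algebra, field_char_0})"
  by (cases r) (simp add: Fract_of_int_quotient of_rat_divide)

lemma linear_combination_irrational:
  fixes x :: real
  assumes "x \<notin> \<rat>" "of_rat a + of_rat b * x = 0"
  shows "a = 0 \<and> b = 0"
proof (cases "b = 0")
  case True
  then show ?thesis using assms by simp
next
  case False
  then have "x = of_rat (- a / b)"
    using assms(2) by (simp add: of_rat_divide of_rat_minus field_simps)
  then show ?thesis using assms(1) by auto
qed

lemma low_degree_irrational_root:
  fixes x :: real and r :: "rat poly"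
  assumes "x \<notin> \<rat>" "poly (map_poly of_rat r) x = 0" "degree r \<le> 1"
  shows "r = 0"
proof -
  have r: "r = [:coeff r 0, coeff r 1:]"
    using assms(3) by (intro poly_eqI) (auto simp: coeff_pCons coeff_eq_0 split: nat.splits)
  have "of_rat (coeff r 0) + of_rat (coeff r 1) * x = 0"
    using assms(2) by (subst (asm) r) (simp add: of_rat_hom.map_poly_pCons_hom mult_ac)
  from linear_combination_irrational[OF assms(1) this] show ?thesis
    using r by simp
qed

text \<open>The irrational root x is a root of one of the two factors, which then has degree at
  least 2 and leaves the other constant.\<close>

lemma irreducible_quadratic:
  fixes x :: real
  assumes x: "x \<notin> \<rat>" and p: "degree p = 2" "poly (map_poly of_rat p) x = 0"
  shows "irreducible (p :: rat poly)"
proof (rule irreducibleI)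
  show "p \<noteq> 0" using p by auto
  then show "\<not> p dvd 1" using p by (simp add: is_unit_iff_degree)
  fix a b assume ab: "p = a * b"
  then have nz: "a \<noteq> 0" "b \<noteq> 0" using p by auto
  then have deg: "degree a + degree b = 2"
    using p ab by (simp add: degree_mult_eq)
  have "poly (map_poly of_rat a) x * poly (map_poly of_rat b) x = 0"
    using p ab by (simp add: map_poly_of_rat_mult)
  then consider "poly (map_poly of_rat a) x = 0" | "poly (map_poly of_rat b) x = 0"
    by auto
  then show "a dvd 1 \<or> b dvd 1"
  proof cases
    case 1
    then have "\<not> degree a \<le> 1" using low_degree_irrational_root[OF x] nz by blast
    then show ?thesis using deg nz by (simp add: is_unit_iff_degree)
  next
    case 2
    then have "\<not> degree b \<le> 1" using low_degree_irrational_root[OF x] nz by blast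
    then show ?thesis using deg nz by (simp add: is_unit_iff_degree)
  qed
qed

text \<open>The quadratic m = X^2 - t X + n divides every rational polynomial vanishing at x, since
  a nonzero remainder of degree at most 1 has no irrational root. Dividing a monic integer
  polynomial, m has integer coefficients by Gauss. The equation for x is in the Horner form to which
  \<open>poly\<close> unfolds.\<close>

lemma algebraic_int_quadratic:
  fixes x :: real
  assumes x: "x \<notin> \<rat>" and ai: "algebraic_int x"
    and root: "of_rat n + x * (- of_rat t + x) = 0"
  shows "t \<in> \<int> \<and> n \<in> \<int>"
proof -
  obtain P where P: "lead_coeff P = 1" "poly (map_poly of_int P) x = 0"
    using ai by (auto simp: algebraic_int_altdef_ipoly)
  define m where "m = [:n, - t, 1:]"
  define P' where "P' = (map_poly of_int P :: rat poly)"
  have m: "m \<noteq> 0" "degree m = 2" "lead_coeff m = 1"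
    by (auto simp: m_def)
  have m0: "poly (map_poly of_rat m) x = 0"
    using root by (simp add: m_def of_rat_hom.map_poly_pCons_hom of_rat_minus)
  have P'0: "poly (map_poly of_rat P') x = 0"
    using P(2) by (simp add: P'_def map_poly_map_poly o_def)
  have "poly (map_poly of_rat (P' mod m)) x = 0"
  proof -
    have "map_poly of_rat P' = (map_poly of_rat (P' div m) * map_poly of_rat m + map_poly of_rat (P' mod m) :: real poly)"
      by (metis div_mult_mod_eq map_poly_of_rat_mult map_poly_of_rat_add)
    then show ?thesis using P'0 m0 by simp
  qed
  moreover have "degree (P' mod m) \<le> 1"
    using degree_mod_less[of m P'] m by auto
  ultimately have "P' mod m = 0"
    using low_degree_irrational_root[OF x] by blast
  then obtain h where h: "P' = m * h" by auto
  have "lead_coeff P' = 1"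
    using P(1) by (simp add: P'_def)
  then have "lead_coeff h = 1"
    using h m by (simp add: lead_coeff_mult)
  then have "coeff m i \<in> \<int>" for i
    using gauss_monic_factor m h P'_def by metis
  from this[of 0] this[of 1] show ?thesis
    by (simp add: m_def)
qed

lemma algebraic_int_quadraticI:
  fixes x :: "'a :: field"
  assumes "x ^ 2 - of_int t * x + of_int n = 0"
  shows "algebraic_int x"
proof (rule algebraic_int.intros)
  let ?p = "[:of_int n, - of_int t, 1:] :: 'a poly"
  show "lead_coeff ?p = 1" by simp
  show "\<forall>i. coeff ?p i \<in> \<int>"
    by (auto simp: coeff_pCons split: nat.splits)
  show "poly ?p x = 0"
    using assms by (simp add: algebra_simps power2_eq_square)
qed

section \<open>A small determinant and the approximation criterion\<close>

lemma det_mat_2: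
  "Determinant.det (Matrix.mat 2 2 f) = f (0, 0) * f (1, 1) - f (0, 1) * f (1, 0)"
proof -
  have minor: "Determinant.det (mat_delete (Matrix.mat 2 2 f) i 0) = f (1 - i, 1)" if "i < 2" for i
    using that by (subst det_single) (auto simp: mat_delete_def less_2_cases_iff)
  have "Determinant.det (Matrix.mat 2 2 f) =
      (\<Sum>i<2. Matrix.mat 2 2 f $$ (i, 0) * cofactor (Matrix.mat 2 2 f) i 0)"
    by (rule laplace_expansion_column) auto
  then show ?thesis
    by (simp add: numeral_2_eq_2 lessThan_Suc cofactor_def minor[unfolded numeral_2_eq_2] mult_ac)
qed

text \<open>The distance from \<open>\<alpha> * \<zeta> ^ n\<close> to the given integer is
  \<open>\<bar>\<beta>\<bar> * \<bar>z'\<bar> ^ n\<close>, which decays geometrically and bounds the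
  distance to the nearest integer. In the applications z' and \<open>\<beta>\<close> are the
  conjugates of \<open>\<zeta>\<close> and \<open>\<alpha>\<close>.\<close>

lemma M_setI:
  assumes z: "\<bar>z'\<bar> < 1" and int: "\<And>n. \<alpha> * \<zeta> ^ n + \<beta> * z' ^ n \<in> \<int>"
  shows "\<alpha> \<in> M_set \<zeta>"
proof -
  have "(\<lambda>n. \<bar>z'\<bar> ^ n) \<longlonglongrightarrow> 0"
    using z by (intro LIMSEQ_power_zero) simp
  then have lim: "(\<lambda>n. \<bar>\<beta>\<bar> * \<bar>z'\<bar> ^ n) \<longlonglongrightarrow> 0"
    by (rule tendsto_mult_right_zero)
  have "dist_nearest_int (\<alpha> * \<zeta> ^ n) \<le> \<bar>\<beta>\<bar> * \<bar>z'\<bar> ^ n" for n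
  proof -
    obtain k where "\<alpha> * \<zeta> ^ n + \<beta> * z' ^ n = of_int k"
      using int[of n] by (auto elim: Ints_cases)
    then have "\<bar>\<alpha> * \<zeta> ^ n - of_int k\<bar> = \<bar>\<beta>\<bar> * \<bar>z'\<bar> ^ n"
      by (metis abs_minus_commute abs_mult add_diff_cancel_left' power_abs)
    then show ?thesis
      using round_diff_minimal[of "\<alpha> * \<zeta> ^ n" k] by (simp add: dist_nearest_int_def)
  qed
  then have "(\<lambda>n. dist_nearest_int (\<alpha> * \<zeta> ^ n)) \<longlonglongrightarrow> 0"
    by (intro real_tendsto_sandwich[OF _ _ tendsto_const lim] always_eventually)
      (auto simp: dist_nearest_int_def)
  then show ?thesis by (simp add: M_set_def)
qed

section \<open>Real quadratic fields\<close>

locale real_quadratic_field =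
  fixes d :: nat
  assumes d_gt_1: "d > 1" and squarefree_d: "squarefree d"
begin

abbreviation s :: real where "s \<equiv> sqrt (real d)"

definition quad :: "rat \<Rightarrow> rat \<Rightarrow> real" where
  "quad p q = of_rat p + of_rat q * s"

text \<open>Given through the coordinates p and q, which are unique because s is irrational; only
  its values on the field matter.\<close>

definition quad_conj :: "real \<Rightarrow> real" where
  "quad_conj x = (THE y. \<exists>p q. x = quad p q \<and> y = quad p (- q))"

definition disc :: int where
  "disc = (if d mod 4 = 1 then int d else 4 * int d)"

text \<open>This generator treats both residue classes together: it is (1 + s) / 2 plus the integer
  (d - 1) / 2 when d is 1 modulo 4, and s + 2 d otherwise.\<close>

definition omega :: real where
  "omega = (of_int disc + sqrt (of_int disc)) / 2"

definition elem :: "int \<Rightarrow> int \<Rightarrow> real" where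
  "elem u v = of_int u + of_int v * omega"

section \<open>Arithmetic of the numbers p + q sqrt d\<close>

lemma s_square: "s * s = real d"
  by simp

lemma s_irrational: "s \<notin> \<rat>"
proof
  assume "s \<in> \<rat>"
  moreover have "algebraic_int s" by auto
  ultimately have "s \<in> \<int>"
    using rational_algebraic_int_is_int by blast
  then obtain k where k: "s = of_int k" by (auto elim: Ints_cases)
  then have "of_int (k * k) = (of_int (int d) :: real)"
    using s_square by simp
  then have kd: "k * k = int d"
    by (simp only: of_int_eq_iff)
  then have "int (nat \<bar>k\<bar> ^ 2) = int d"
    by (simp add: power2_eq_square)
  then have kd': "nat \<bar>k\<bar> ^ 2 = d"
    by (simp only: of_nat_eq_iff)
  then have "nat \<bar>k\<bar> dvd 1"
    by (intro squarefreeD[OF squarefree_d]) simp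
  then have "d = 1"
    using kd' by simp
  then show False using d_gt_1 by simp
qed

lemma quad_eq_iff: "quad p q = quad p' q' \<longleftrightarrow> p = p' \<and> q = q'"
proof
  assume "quad p q = quad p' q'"
  then have "of_rat (p - p') + of_rat (q - q') * s = 0"
    by (simp add: quad_def of_rat_diff algebra_simps)
  from linear_combination_irrational[OF s_irrational this]
  show "p = p' \<and> q = q'" by simp
qed simp

lemma quad_irrational:
  assumes "q \<noteq> 0"
  shows "quad p q \<notin> \<rat>"
proof
  assume "quad p q \<in> \<rat>"
  then obtain r where "quad p q = of_rat r" by (auto elim: Rats_cases)
  then have "quad p q = quad r 0" by (simp add: quad_def)
  then show False using assms by (simp add: quad_eq_iff)
qed

lemma quad_conj_quad [simp]: "quad_conj (quad p q) = quad p (- q)"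
  unfolding quad_conj_def by (rule the_equality) (auto simp: quad_eq_iff)

lemma quad_add: "quad p q + quad p' q' = quad (p + p') (q + q')"
  by (simp add: quad_def of_rat_add algebra_simps)

lemma quad_diff: "quad p q - quad p' q' = quad (p - p') (q - q')"
  by (simp add: quad_def of_rat_diff algebra_simps)

lemma quad_mult: "quad p q * quad p' q' = quad (p * p' + of_nat d * q * q') (p * q' + q * p')"
proof -
  have "quad p q * quad p' q' = of_rat p * of_rat p' + (s * s) * of_rat q * of_rat q'
      + (of_rat p * of_rat q' + of_rat q * of_rat p') * s"
    unfolding quad_def by (simp only: algebra_simps)
  then show ?thesis
    unfolding s_square by (simp add: quad_def of_rat_add of_rat_mult)
qed

text \<open>The denominator is the norm, the product of the number with its conjugate, and vanishes
  only at p = q = 0. There both sides are 0 by the convention on division by zero.\<close>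

lemma quad_inverse: "inverse (quad p q) = quad (p / (p^2 - of_nat d * q^2)) (- q / (p^2 - of_nat d * q^2))"
proof (cases "p = 0 \<and> q = 0")
  case True
  then show ?thesis by (simp add: quad_def)
next
  case False
  let ?n = "p^2 - of_nat d * q^2"
  have "quad p q * quad p (- q) = quad ?n 0"
    by (simp add: quad_mult power2_eq_square mult.assoc)
  moreover have "quad p q \<noteq> quad 0 0" "quad p (- q) \<noteq> quad 0 0"
    using False by (auto simp: quad_eq_iff)
  moreover have "quad 0 0 = 0"
    by (simp add: quad_def)
  ultimately have n: "?n \<noteq> 0"
    by (metis mult_eq_0_iff)
  have "p * (p / N) + of_nat d * q * (- q / N) = (p * p - of_nat d * q * q) / N" for N
    by (simp add: diff_divide_distrib)
  then have "p * (p / ?n) + of_nat d * q * (- q / ?n) = ?n / ?n"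
    by (simp add: power2_eq_square mult.assoc)
  also have "\<dots> = 1" using n by simp
  finally have "quad p q * quad (p / ?n) (- q / ?n) = quad 1 0"
    unfolding quad_mult quad_eq_iff by simp
  then have "quad p q * quad (p / ?n) (- q / ?n) = 1"
    by (simp add: quad_def)
  then show ?thesis by (rule inverse_unique)
qed

lemma quad_of_rat: "quad p 0 = of_rat p"
  by (simp add: quad_def)

lemma quad_root: "of_rat (p^2 - of_nat d * q^2) + quad p q * (- of_rat (2 * p) + quad p q) = 0"
proof -
  have "of_rat (p^2 - of_nat d * q^2) + quad p q * (- of_rat (2 * p) + quad p q)
      = quad (p^2 - of_nat d * q^2) 0 + quad p q * (quad (- (2 * p)) 0 + quad p q)"
    by (simp only: quad_of_rat of_rat_minus)
  also have "\<dots> = quad 0 0"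
    unfolding quad_add quad_mult quad_eq_iff by (simp add: power2_eq_square algebra_simps)
  finally show ?thesis by (simp add: quad_of_rat)
qed

lemma rat_adjoin_quad:
  assumes "q \<noteq> 0"
  shows "rat_adjoin (quad p q) = range (case_prod quad)"
proof
  have mem: "quad a b \<in> range (case_prod quad)" for a b
    using rangeI[of "case_prod quad" "(a, b)"] by simp
  have "is_subfield (range (case_prod quad))"
    unfolding is_subfield_def
  proof (intro conjI ballI)
    show "0 \<in> range (case_prod quad)" "1 \<in> range (case_prod quad)"
      using mem[of 0 0] mem[of 1 0] by (simp_all add: quad_of_rat)
  qed (auto simp: quad_diff quad_mult quad_inverse mem)
  then show "rat_adjoin (quad p q) \<subseteq> range (case_prod quad)"
    using mem by (rule rat_adjoin_minimal)
  show "range (case_prod quad) \<subseteq> rat_adjoin (quad p q)"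
  proof clarsimp
    fix a b
    \<comment> \<open>Obtained by substituting s = (\<open>quad p q\<close> - p) / q into a + b
      s.\<close>
    have "quad a b = of_rat (a - b / q * p) + of_rat (b / q) * quad p q"
      using assms by (simp add: quad_def of_rat_diff of_rat_mult of_rat_divide field_simps)
    moreover have "of_rat (b / q) * quad p q \<in> rat_adjoin (quad p q)"
      using is_subfield_rat_adjoin[of "quad p q"] rat_adjoin_self
        of_rat_in_subfield[OF is_subfield_rat_adjoin]
      unfolding is_subfield_def by blast
    ultimately show "quad a b \<in> rat_adjoin (quad p q)"
      by (simp add: subfield_add of_rat_in_subfield is_subfield_rat_adjoin)
  qed
qed

section \<open>The quadratic field and its embeddings\<close>

definition K :: "real set" where
  "K = range (case_prod quad)"

lemma rat_adjoin_sqrt: "rat_adjoin s = K"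
  \<comment> \<open>The assumption of the lemma mentions q first, so this is q = 1, p = 0.\<close>
  using rat_adjoin_quad[of 1 0] by (simp add: K_def quad_def)

lemma is_subfield_K: "is_subfield K"
  using is_subfield_rat_adjoin rat_adjoin_sqrt by metis

lemma quad_in_K [simp]: "quad p q \<in> K"
  by (auto simp: K_def)

lemma in_K_cases:
  assumes "x \<in> K"
  obtains p q where "x = quad p q"
  using assms by (auto simp: K_def)

lemma quad_conj_add: "x \<in> K \<Longrightarrow> y \<in> K \<Longrightarrow> quad_conj (x + y) = quad_conj x + quad_conj y"
  by (auto elim!: in_K_cases simp: quad_add)

lemma quad_conj_mult: "x \<in> K \<Longrightarrow> y \<in> K \<Longrightarrow> quad_conj (x * y) = quad_conj x * quad_conj y"
  by (auto elim!: in_K_cases simp: quad_mult quad_eq_iff)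

text \<open>An embedding fixes the rationals, so it is determined by the image of s, which must be
  one of the two square roots of d.\<close>

lemma embeddings_K:
  "embeddings K = {restrict of_real K, restrict (\<lambda>x. of_real (quad_conj x)) K}"
proof (intro equalityI subsetI)
  fix \<sigma> assume \<sigma>: "\<sigma> \<in> embeddings K"
  have add: "\<sigma> (x + y) = \<sigma> x + \<sigma> y" and mult: "\<sigma> (x * y) = \<sigma> x * \<sigma> y"
    if "x \<in> K" "y \<in> K" for x y
    using \<sigma> that by (auto simp: embeddings_def)
  have ext: "\<sigma> \<in> extensional K"
    using \<sigma> by (auto simp: embeddings_def)
  have rat: "\<sigma> (of_rat r) = of_rat r" for r
    by (rule embedding_of_rat[OF is_subfield_K \<sigma>])
  have ratK: "of_rat r \<in> K" for r
    by (rule of_rat_in_subfield[OF is_subfield_K])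
  have sK: "s \<in> K" using quad_in_K[of 0 1] by (simp add: quad_def)
  have prodK: "of_rat q * s \<in> K" for q
    using quad_in_K[of 0 q] by (simp add: quad_def)
  have \<sigma>_quad: "\<sigma> (quad p q) = of_rat p + of_rat q * \<sigma> s" for p q
    unfolding quad_def by (simp add: add mult rat ratK sK prodK)
  have "\<sigma> s * \<sigma> s = of_nat d"
    using mult[OF sK sK] rat[of "of_nat d"] by (simp add: s_square)
  moreover have "of_real s * of_real s = (of_nat d :: complex)"
    unfolding of_real_mult[symmetric] s_square by simp
  ultimately have "(\<sigma> s - of_real s) * (\<sigma> s + of_real s) = 0"
    by (simp add: algebra_simps)
  then consider "\<sigma> s = of_real s" | "\<sigma> s = - of_real s"
    by (auto simp: eq_neg_iff_add_eq_0)
  then show "\<sigma> \<in> {restrict of_real K, restrict (\<lambda>x. of_real (quad_conj x)) K}"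
  proof cases
    case 1
    have "\<sigma> = restrict of_real K"
      by (rule extensionalityI[OF ext]) 
        (auto elim!: in_K_cases simp: \<sigma>_quad 1, simp add: quad_def of_real_of_rat)
    then show ?thesis by simp
  next
    case 2
    have "\<sigma> = restrict (\<lambda>x. of_real (quad_conj x)) K"
      by (rule extensionalityI[OF ext])
        (auto elim!: in_K_cases simp: \<sigma>_quad 2, simp add: quad_def of_rat_minus of_real_of_rat)
    then show ?thesis by simp
  qed
next
  have closed: "x + y \<in> K" "x * y \<in> K" if "x \<in> K" "y \<in> K" for x y
    using that by (auto elim!: in_K_cases simp: quad_add quad_mult)
  have one: "1 \<in> K" "quad_conj 1 = 1"
    using quad_in_K[of 1 0] quad_conj_quad[of 1 0] by (simp_all add: quad_of_rat)
  fix \<sigma> :: "real \<Rightarrow> complex"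
  assume "\<sigma> \<in> {restrict of_real K, restrict (\<lambda>x. of_real (quad_conj x)) K}"
  then show "\<sigma> \<in> embeddings K"
    by (auto simp: embeddings_def closed one quad_conj_add quad_conj_mult)
qed

lemma field_trace_K:
  assumes "x \<in> K"
  shows "field_trace K x = of_real (x + quad_conj x)"
proof -
  have sK: "s = quad 0 1" by (simp add: quad_def)
  \<comment> \<open>The two embeddings disagree at s; without this the sum over the set of
    embeddings could collapse to one term.\<close>
  have "s \<noteq> quad_conj s"
    unfolding sK by (simp add: quad_eq_iff)
  then have "restrict complex_of_real K s \<noteq> restrict (\<lambda>x. of_real (quad_conj x)) K s"
    using quad_in_K[of 0 1] by (simp add: sK)
  then have "restrict complex_of_real K \<noteq> restrict (\<lambda>x. of_real (quad_conj x)) K"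
    by metis
  then show ?thesis
    using assms by (simp add: field_trace_def embeddings_K)
qed

section \<open>The ring of integers\<close>

lemma sqrt_disc: "sqrt (of_int disc) = (if d mod 4 = 1 then s else 2 * s)"
  by (simp add: disc_def real_sqrt_mult)

lemma disc_ge: "disc \<ge> 5"
proof (cases "d mod 4 = 1")
  case True
  then have "d \<noteq> 2" "d \<noteq> 3" "d \<noteq> 4" by auto
  then show ?thesis using True d_gt_1 by (simp add: disc_def)
next
  case False
  then show ?thesis using d_gt_1 by (simp add: disc_def)
qed

text \<open>Makes the norm (D^2 - D) / 4 of \<open>omega\<close> an integer; its trace is D.\<close>

lemma disc_cong: "4 dvd disc * disc - disc"
proof (cases "d mod 4 = 1")
  case True
  then have "4 dvd int d - 1"
    by presburger
  then have "4 dvd int d * (int d - 1)" by (rule dvd_mult)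
  then show ?thesis using True by (simp add: disc_def algebra_simps)
next
  case False
  have "disc * disc - disc = 4 * (int d * (4 * int d) - int d)"
    using False by (simp add: disc_def algebra_simps)
  then show ?thesis by simp
qed

lemma omega_square: "omega * omega = of_int disc * omega - of_int ((disc * disc - disc) div 4)"
proof -
  have "sqrt (of_int disc) * sqrt (of_int disc) = of_int disc"
    using disc_ge by simp
  moreover have "of_int ((disc * disc - disc) div 4) = (of_int disc * of_int disc - of_int disc) / (4 :: real)"
    using disc_cong by (simp add: real_of_int_div)
  ultimately show ?thesis
    by (simp add: omega_def field_simps)
qed

lemma elem_eq_quad:
  "elem u v = quad (of_int u + of_int v * of_int disc / 2)
     (of_int v * (if d mod 4 = 1 then 1 / 2 else 1))"
  by (simp add: elem_def omega_def sqrt_disc quad_def of_rat_add of_rat_mult of_rat_divide field_simps)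

lemma elem_in_K [simp]: "elem u v \<in> K"
  by (simp add: elem_eq_quad)

lemma quad_conj_elem:
  "quad_conj (elem u v) = of_int u + of_int v * (of_int disc - sqrt (of_int disc)) / 2"
  unfolding elem_eq_quad quad_conj_quad
  by (simp add: sqrt_disc quad_def of_rat_add of_rat_mult of_rat_divide of_rat_minus field_simps)

lemma elem_eq_iff: "elem u v = elem u' v' \<longleftrightarrow> u = u' \<and> v = v'"
  by (auto simp: elem_eq_quad quad_eq_iff split: if_splits)

lemma elem_mult: "elem u v * elem u' v' =
  elem (u * u' - v * v' * ((disc * disc - disc) div 4)) (u * v' + v * u' + v * v' * disc)"
proof -
  have "elem u v * elem u' v' = of_int u * of_int u' + of_int v * of_int v' * (omega * omega)
      + (of_int u * of_int v' + of_int v * of_int u') * omega"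
    unfolding elem_def by (simp only: algebra_simps)
  then show ?thesis
    unfolding omega_square by (simp add: elem_def algebra_simps del: of_int_div)
qed

lemma algebraic_int_elem: "algebraic_int (elem u v)"
proof (rule algebraic_int_quadraticI)
  let ?C = "(disc * disc - disc) div 4"
  have "elem u v ^ 2 - of_int (2 * u + v * disc) * elem u v + of_int (u * u + u * v * disc + v * v * ?C)
      = of_int v * of_int v * (omega * omega - of_int disc * omega + of_int ?C)"
    unfolding elem_def of_int_add of_int_mult of_int_numeral
    by (simp add: algebra_simps power2_eq_square del: of_int_div)
  then show "elem u v ^ 2 - of_int (2 * u + v * disc) * elem u v
      + of_int (u * u + u * v * disc + v * v * ?C) = 0"
    by (simp add: omega_square)
qed

text \<open>The square of the denominator of b is coprime to that of the numerator, so it divides d,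
  and squarefreeness makes it 1.\<close>

lemma square_mult_int_imp_int:
  fixes b :: rat
  assumes "of_nat d * b ^ 2 \<in> \<int>"
  shows "b \<in> \<int>"
proof -
  obtain m n where mn: "quotient_of b = (m, n)" by fastforce
  then have b: "b = of_int m / of_int n" and n: "n > 0" and cop: "coprime m n"
    using quotient_of_div quotient_of_denom_pos quotient_of_coprime by blast+
  obtain k where "of_nat d * b ^ 2 = of_int k"
    using assms by (auto elim: Ints_cases)
  then have "of_int (int d * m ^ 2) = (of_int (k * n ^ 2) :: rat)"
    using n by (simp add: b field_simps)
  then have "int d * m ^ 2 = k * n ^ 2"
    by (simp only: of_int_eq_iff)
  then have "n ^ 2 dvd int d * m ^ 2" by simp
  moreover have "coprime (n ^ 2) (m ^ 2)"
    using cop by (simp add: coprime_commute)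
  ultimately have "n ^ 2 dvd int d"
    by (simp add: coprime_dvd_mult_left_iff)
  then have "nat n ^ 2 dvd d"
    using n by (metis int_dvd_int_iff int_nat_eq less_imp_le of_nat_power)
  then have "nat n dvd 1" by (rule squarefreeD[OF squarefree_d])
  then have "n = 1" using n by simp
  then show ?thesis using b by simp
qed

text \<open>For p = a / 2 and q = b / 2 the assumption says that the norm of p + q s is an integer.
  Squares are 0 or 1 modulo 4: two odd numbers force d to be 1 modulo 4, and only b odd would force
  4 to divide d.\<close>

lemma half_integers_mod_4:
  fixes a b :: int
  assumes "4 dvd a ^ 2 - int d * b ^ 2"
  shows "if d mod 4 = 1 then even (a - b) else even a \<and> even b"
proof -
  have d0: "\<not> 4 dvd d"
    using squarefreeD[OF squarefree_d, of 2] by auto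
  have dvd4: "4 dvd x ^ 2" if "even x" for x :: int
    using that by (auto simp: power2_eq_square)
  have odd4: "x ^ 2 mod 4 = 1" if odd: "odd x" for x :: int
  proof -
    obtain k where "x = 2 * k + 1" using odd by (auto elim: oddE)
    then have "x ^ 2 = 4 * (k * k + k) + 1" by (simp add: power2_eq_square algebra_simps)
    then show ?thesis by presburger
  qed
  have sq: "x ^ 2 mod 4 = (if even x then 0 else 1)" for x :: int
    using dvd4[of x] odd4[of x] by auto
  have "(a ^ 2 - int d * b ^ 2) mod 4 = (a ^ 2 mod 4 - int d * (b ^ 2 mod 4)) mod 4"
    by (intro mod_diff_cong mod_mult_cong) simp_all
  then have *: "((if even a then 0 else 1) - int d * (if even b then 0 else 1)) mod 4 = 0"
    using assms unfolding sq by simp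
  show ?thesis
  proof (cases "even a"; cases "even b")
  qed (use * d0 in \<open>simp_all; presburger\<close>)+
qed

lemma ring_of_integers_K: "ring_of_integers K = range (case_prod elem)"
proof (intro equalityI subsetI)
  fix x assume "x \<in> range (case_prod elem)"
  then show "x \<in> ring_of_integers K"
    by (auto simp: ring_of_integers_def algebraic_int_elem)
next
  fix x assume "x \<in> ring_of_integers K"
  then have ai: "algebraic_int x" and "x \<in> K"
    by (auto simp: ring_of_integers_def)
  then obtain p q where x: "x = quad p q"
    by (auto elim: in_K_cases)
  have "\<exists>u v. x = elem u v"
  proof (cases "q = 0")
    case True
    then have "x \<in> \<rat>" by (simp add: x quad_of_rat)
    then obtain k where "x = of_int k"
      using rational_algebraic_int_is_int[OF ai] by (auto elim: Ints_cases)
    then have "x = elem k 0" by (simp add: elem_def)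
    then show ?thesis by blast
  next
    case False
    have irr: "x \<notin> \<rat>"
      by (rule quad_irrational[OF False, of p, folded x])
    have "2 * p \<in> \<int> \<and> p^2 - of_nat d * q^2 \<in> \<int>"
      by (rule algebraic_int_quadratic[OF irr ai]) (unfold x, rule quad_root)
    then obtain a N where a: "2 * p = of_int a" and N: "p^2 - of_nat d * q^2 = of_int N"
      by (elim conjE Ints_cases)
    \<comment> \<open>Trace and norm control only 2 p and d q^2; this identity transfers integrality
      to 2 q.\<close>
    have "of_nat d * (2 * q)^2 = (2 * p)^2 - 4 * (p^2 - of_nat d * q^2)"
      by (simp add: power_mult_distrib)
    also have "\<dots> = of_int (a^2 - 4 * N)"
      unfolding a N by simp
    finally have db: "of_nat d * (2 * q)^2 = of_int (a^2 - 4 * N)" .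
    have "2 * q \<in> \<int>"
      by (rule square_mult_int_imp_int) (simp only: db Ints_of_int)
    then obtain b where b: "2 * q = of_int b" by (rule Ints_cases)
    have "of_int (int d * b^2) = (of_int (a^2 - 4 * N) :: rat)"
      using db unfolding b by simp
    then have "int d * b^2 = a^2 - 4 * N" by (simp only: of_int_eq_iff)
    then have "4 dvd a^2 - int d * b^2" by simp
    note parity = half_integers_mod_4[OF this]
    have pq: "p = of_int a / 2" "q = of_int b / 2"
      using a b by simp_all
    show ?thesis
    proof (cases "d mod 4 = 1")
      case True
      then have "odd d" by presburger
      then have "even (a - b * disc)"
        using parity True by (auto simp: disc_def)
      then obtain u where "a - b * disc = 2 * u" by (rule evenE)
      then have a': "a = 2 * u + b * disc" by simp
      have "x = elem u b"
        unfolding x elem_eq_quad pq quad_eq_iff a' using True by (simp add: add_divide_distrib)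
      then show ?thesis by blast
    next
      case False
      then have "even a" "even b"
        using parity by simp_all
      then obtain a' b' where a': "a = 2 * a'" and b': "b = 2 * b'"
        by (elim evenE)
      \<comment> \<open>Here \<open>omega\<close> = 2 d + s, so b' s = b' \<open>omega\<close> - 2 d
        b'.\<close>
      have "x = elem (a' - 2 * int d * b') b'"
        unfolding x elem_eq_quad pq quad_eq_iff a' b' using False by (simp add: disc_def)
      then show ?thesis by blast
    qed
  qed
  then show "x \<in> range (case_prod elem)" by auto
qed

lemma elem_add: "elem u v + elem u' v' = elem (u + u') (v + v')"
  by (simp add: elem_def algebra_simps)

lemma of_int_mult_elem: "of_int c * elem u v = elem (c * u) (c * v)"
  by (simp add: elem_def algebra_simps)

lemma elem_0: "elem 0 0 = 0"
  by (simp add: elem_def)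

lemma elem_trace: "elem u v + quad_conj (elem u v) = of_int (2 * u + v * disc)"
  unfolding quad_conj_elem by (simp add: elem_def omega_def field_simps)

section \<open>Integral bases and the discriminant\<close>

lemma integral_basis_1_omega: "integral_basis K [elem 1 0, elem 0 1]"
  unfolding integral_basis_def
proof (intro conjI ballI)
  show "set [elem 1 0, elem 0 1] \<subseteq> ring_of_integers K"
    by (force simp: ring_of_integers_K image_iff)
  fix x assume "x \<in> ring_of_integers K"
  then obtain u v where x: "x = elem u v" by (auto simp: ring_of_integers_K)
  let ?bs = "[elem 1 0, elem 0 1]"
  have sum: "(\<Sum>i<length ?bs. of_int ([a, b] ! i) * ?bs ! i) = elem a b" for a b
    by (simp add: of_int_mult_elem elem_add)
  show "\<exists>!c :: int list. length c = length ?bs \<and> x = (\<Sum>i<length ?bs. of_int (c ! i) * ?bs ! i)"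
  proof (rule ex1I[of _ "[u, v]"])
    show "length [u, v] = length ?bs \<and> x = (\<Sum>i<length ?bs. of_int ([u, v] ! i) * ?bs ! i)"
      unfolding sum x by simp
  next
    fix c :: "int list"
    assume c: "length c = length ?bs \<and> x = (\<Sum>i<length ?bs. of_int (c ! i) * ?bs ! i)"
    then obtain a b where ab: "c = [a, b]"
      by (auto simp: length_Suc_conv)
    then have "x = elem a b"
      using c unfolding ab sum by blast
    then show "c = [u, v]"
      by (simp add: ab x elem_eq_iff)
  qed
qed

text \<open>\<open>integral_basis\<close> does not prescribe a length. Fewer than two elements
  cannot span the rank-two lattice, and three or more contradict uniqueness of the coordinates of 0.
  With two elements, the coordinate matrix has an integer inverse, hence determinant 1 or
  -1.\<close>

lemma integral_basis_unimodular:
  assumes "integral_basis K bs"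
  obtains u0 v0 u1 v1 where "bs = [elem u0 v0, elem u1 v1]" "(u0 * v1 - u1 * v0)^2 = 1"
proof -
  let ?S = "\<lambda>c :: int list. \<Sum>i<length bs. of_int (c ! i) * bs ! i"
  have ex1: "\<exists>!c :: int list. length c = length bs \<and> elem u v = ?S c" for u v
    using assms by (auto simp: integral_basis_def ring_of_integers_K)
  have mem: "\<exists>u v. b = elem u v" if "b \<in> set bs" for b
  proof -
    have "b \<in> range (case_prod elem)"
      using assms that unfolding integral_basis_def ring_of_integers_K by blast
    then show ?thesis by auto
  qed
  have uniq: "c = c'" if "length c = length bs" "length c' = length bs" "?S c = 0" "?S c' = 0" for c c'
    using ex1[of 0 0] that by (auto simp: elem_0)
  consider "bs = []" | b where "bs = [b]" | b0 b1 where "bs = [b0, b1]"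
    | b0 b1 b2 r where "bs = b0 # b1 # b2 # r"
    by (metis neq_Nil_conv)
  then show thesis
  proof cases
    case 1
    then have "elem 1 0 = elem 0 0" using ex1[of 1 0] by (auto simp: elem_0)
    then show thesis by (simp add: elem_eq_iff)
  next
    case (2 b)
    obtain u v where b: "b = elem u v" using mem[of b] 2 by auto
    have "\<exists>c. elem i j = elem (c * u) (c * v)" for i j
    proof -
      obtain c :: "int list" where "length c = length bs" "elem i j = ?S c"
        using ex1[of i j] by blast
      then show ?thesis by (auto simp: 2 b of_int_mult_elem)
    qed
    \<comment> \<open>The first instance forces v = 0, which contradicts the second.\<close>
    from this[of 1 0] this[of 0 1] show thesis
      by (auto simp: elem_eq_iff)
  next
    case (3 b0 b1)
    obtain u0 v0 where b0: "b0 = elem u0 v0" using mem[of b0] 3 by auto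
    obtain u1 v1 where b1: "b1 = elem u1 v1" using mem[of b1] 3 by auto
    have rep: "\<exists>c0 c1. i = c0 * u0 + c1 * u1 \<and> j = c0 * v0 + c1 * v1" for i j
    proof -
      obtain c :: "int list" where c: "length c = length bs" "elem i j = ?S c"
        using ex1[of i j] by blast
      then have "elem i j = elem (c ! 0 * u0 + c ! 1 * u1) (c ! 0 * v0 + c ! 1 * v1)"
        by (simp add: 3 b0 b1 of_int_mult_elem elem_add)
      then show ?thesis by (auto simp: elem_eq_iff)
    qed
    obtain c0 c1 where c: "1 = c0 * u0 + c1 * u1" "0 = c0 * v0 + c1 * v1"
      using rep[of 1 0] by blast
    obtain e0 e1 where e: "0 = e0 * u0 + e1 * u1" "1 = e0 * v0 + e1 * v1"
      using rep[of 0 1] by blast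
    \<comment> \<open>Multiplicativity of the determinant: the rows (c0, c1) and (e0, e1) express 1
      and \<open>omega\<close> in the given basis.\<close>
    have "(c0 * e1 - c1 * e0) * (u0 * v1 - u1 * v0)
        = (c0 * u0 + c1 * u1) * (e0 * v0 + e1 * v1) - (c0 * v0 + c1 * v1) * (e0 * u0 + e1 * u1)"
      by (simp add: algebra_simps)
    also have "\<dots> = 1"
      unfolding c[symmetric] e[symmetric] by simp
    finally have "u0 * v1 - u1 * v0 dvd 1"
      by (metis dvd_triv_right)
    then have "(u0 * v1 - u1 * v0)^2 = 1"
      by (simp add: zdvd1_eq power2_eq_1_iff abs_if split: if_splits)
    then show thesis using that 3 b0 b1 by blast
  next
    case (4 b0 b1 b2 r)
    obtain u0 v0 where b0: "b0 = elem u0 v0" using mem[of b0] 4 by auto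
    obtain u1 v1 where b1: "b1 = elem u1 v1" using mem[of b1] 4 by auto
    obtain u2 v2 where b2: "b2 = elem u2 v2" using mem[of b2] 4 by auto
    have indep: "c0 = 0 \<and> c1 = 0 \<and> c2 = 0"
      if "c0 * u0 + c1 * u1 + c2 * u2 = 0" "c0 * v0 + c1 * v1 + c2 * v2 = 0" for c0 c1 c2
    proof -
      have S: "?S (c0 # c1 # c2 # replicate (length r) 0)
          = elem (c0 * u0 + c1 * u1 + c2 * u2) (c0 * v0 + c1 * v1 + c2 * v2)" for c0 c1 c2
      proof -
        have "(\<Sum>i<length r. of_int (replicate (length r) 0 ! i) * r ! i) = 0"
          by (rule sum.neutral) simp
        then show ?thesis
          by (simp add: 4 b0 b1 b2 sum.lessThan_Suc_shift of_int_mult_elem elem_add add.assoc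
              del: sum.lessThan_Suc)
      qed
      have "c0 # c1 # c2 # replicate (length r) 0 = 0 # 0 # 0 # replicate (length r) (0 :: int)"
        by (rule uniq) (unfold S, simp_all add: 4 that elem_0)
      then show ?thesis by simp
    qed
    \<comment> \<open>Three vectors in the plane satisfy the linear relation given by their 2x2 minors.\<close>
    have minors: "u1 * v2 - u2 * v1 = 0" "u2 * v0 - u0 * v2 = 0" "u0 * v1 - u1 * v0 = 0"
      using indep[of "u1 * v2 - u2 * v1" "u2 * v0 - u0 * v2" "u0 * v1 - u1 * v0"]
      by (simp_all add: algebra_simps)
    \<comment> \<open>Since the minor u0 v1 - u1 v0 vanishes, (v1, -v0, 0) and (u1, -u0, 0) are also
      relations. Their triviality makes the first basis vector zero, which is itself
      dependent.\<close>
    have "v0 = 0"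
      using indep[of v1 "- v0" 0] minors by (simp add: algebra_simps)
    moreover have "u0 = 0"
      using indep[of u1 "- u0" 0] minors by (simp add: algebra_simps)
    ultimately have False
      using indep[of 1 0 0] by simp
    then show thesis ..
  qed
qed

text \<open>A change of basis multiplies the Gram determinant by the square of its determinant. For
  the basis 1, \<open>omega\<close> the value is D^2 - 4 C, the discriminant of the minimal
  polynomial of \<open>omega\<close> with trace D and norm C, and this equals D.\<close>

lemma trace_form_det:
  fixes u0 v0 u1 v1 :: int
  defines "bs \<equiv> [elem u0 v0, elem u1 v1]"
  shows "Determinant.det (Matrix.mat (length bs) (length bs)
      (\<lambda>(i, j). field_trace K (bs ! i * bs ! j))) = of_int ((u0 * v1 - u1 * v0)^2 * disc)"
proof -
  define C where "C = (disc * disc - disc) div 4"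
  have C: "disc * disc - 4 * C = disc"
    using disc_cong by (simp add: C_def)
  define T where "T u v u' v' = 2 * (u * u' - v * v' * C) + (u * v' + v * u' + v * v' * disc) * disc"
    for u v u' v'
  have tr: "field_trace K (elem u v * elem u' v') = of_int (T u v u' v')" for u v u' v'
    unfolding elem_mult by (simp add: field_trace_K elem_trace T_def C_def del: of_int_add of_int_mult)
  have "T u0 v0 u0 v0 * T u1 v1 u1 v1 - T u0 v0 u1 v1 * T u1 v1 u0 v0
      = (u0 * v1 - u1 * v0)^2 * (disc * disc - 4 * C)"
    unfolding T_def by (simp add: algebra_simps power2_eq_square)
  then have id: "T u0 v0 u0 v0 * T u1 v1 u1 v1 - T u0 v0 u1 v1 * T u1 v1 u0 v0
      = (u0 * v1 - u1 * v0)^2 * disc"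
    unfolding C .
  have len: "length bs = 2" by (simp add: bs_def)
  show ?thesis
    unfolding len det_mat_2 id[symmetric] by (simp add: bs_def tr)
qed

lemma field_discriminant_K: "field_discriminant K = disc"
  unfolding field_discriminant_def
proof (rule the_equality)
  show "\<exists>bs. integral_basis K bs \<and> of_int disc = Determinant.det (Matrix.mat (length bs) (length bs)
      (\<lambda>(i, j). field_trace K (bs ! i * bs ! j)))"
  proof (intro exI conjI)
    show "integral_basis K [elem 1 0, elem 0 1]" by (rule integral_basis_1_omega)
  qed (unfold trace_form_det, simp)
next
  fix D
  assume "\<exists>bs. integral_basis K bs \<and> of_int D = Determinant.det (Matrix.mat (length bs) (length bs)
      (\<lambda>(i, j). field_trace K (bs ! i * bs ! j)))"
  then obtain bs where bs: "integral_basis K bs"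
    and D: "of_int D = Determinant.det (Matrix.mat (length bs) (length bs)
      (\<lambda>(i, j). field_trace K (bs ! i * bs ! j)))"
    by blast
  from bs obtain u0 v0 u1 v1 where "bs = [elem u0 v0, elem u1 v1]" "(u0 * v1 - u1 * v0)^2 = 1"
    by (rule integral_basis_unimodular)
  with D have "of_int D = (of_int (1 * disc) :: complex)"
    by (simp only: trace_form_det)
  then show "D = disc" by simp
qed

section \<open>Pisot numbers in the field\<close>

text \<open>The assumption on q' covers both the number and its conjugate. The free target type
  serves the real root used for irreducibility and the complex roots used for conjugates.\<close>

lemma quad_poly_root:
  assumes "q'^2 = q^2"
  shows "poly (map_poly of_rat [:p^2 - of_nat d * q^2, - (2 * p), 1:]) (of_real (quad p q'))
    = (0 :: 'a :: {real_div_algebra, field_char_0})"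
proof -
  have "poly (map_poly of_rat [:p^2 - of_nat d * q^2, - (2 * p), 1:]) (of_real (quad p q'))
      = (of_real (of_rat (p^2 - of_nat d * q'^2)
          + quad p q' * (- of_rat (2 * p) + quad p q')) :: 'a)"
    unfolding assms of_real_add of_real_mult of_real_minus of_real_of_rat
    by (simp add: of_rat_hom.map_poly_pCons_hom of_rat_minus)
  then show ?thesis by (simp only: quad_root of_real_0)
qed

lemma pisot_conj_less_1:
  assumes "pisot \<zeta>" "\<zeta> = quad p q" "q \<noteq> 0"
  shows "\<bar>quad_conj \<zeta>\<bar> < 1"
proof -
  define m where "m = [:p^2 - of_nat d * q^2, - (2 * p), 1:]"
  have "irreducible m"
    by (rule irreducible_quadratic[OF quad_irrational[OF assms(3), of p]])
      (use quad_poly_root[of q q p, where ?'a = real] in \<open>simp_all add: m_def\<close>)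
  then have "is_min_poly m (complex_of_real \<zeta>)"
    using quad_poly_root[of q q p] unfolding is_min_poly_def assms(2) m_def by simp
  then have "conjugate_of (of_real (quad_conj \<zeta>)) (of_real \<zeta>)"
    using quad_poly_root[of "- q" q p] unfolding conjugate_of_def assms(2) quad_conj_quad m_def by auto
  moreover have "quad_conj \<zeta> \<noteq> \<zeta>"
    using assms(3) by (simp add: assms(2) quad_eq_iff)
  ultimately have "norm (complex_of_real (quad_conj \<zeta>)) < 1"
    using assms(1) unfolding pisot_def by (metis of_real_eq_iff)
  then show ?thesis by simp
qed

text \<open>A Pisot number is an algebraic integer, so it is rational only if it is an integer;
  every irrational element of K generates K.\<close>

lemma rat_adjoin_eq_K_iff:
  assumes "pisot \<zeta>"
  shows "rat_adjoin \<zeta> = K \<longleftrightarrow> \<zeta> \<in> K - \<int>"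
proof
  assume eq: "rat_adjoin \<zeta> = K"
  have "\<zeta> \<notin> \<rat>"
  proof
    assume "\<zeta> \<in> \<rat>"
    moreover have "is_subfield (\<rat> :: real set)"
      by (auto simp: is_subfield_def)
    ultimately have "K \<subseteq> \<rat>"
      using rat_adjoin_minimal eq by metis
    then show False
      using s_irrational rat_adjoin_sqrt rat_adjoin_self by blast
  qed
  then show "\<zeta> \<in> K - \<int>"
    using eq rat_adjoin_self Ints_subset_Rats by blast
next
  assume \<zeta>: "\<zeta> \<in> K - \<int>"
  then obtain p q where pq: "\<zeta> = quad p q" by (auto elim: in_K_cases)
  have "q \<noteq> 0"
  proof
    assume "q = 0"
    then have "\<zeta> \<in> \<rat>" by (simp add: pq quad_of_rat)
    then show False
      using \<zeta> assms rational_algebraic_int_is_int by (auto simp: pisot_def)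
  qed
  then show "rat_adjoin \<zeta> = K"
    by (simp add: pq rat_adjoin_quad K_def)
qed

text \<open>All powers of \<open>\<zeta>\<close> are integral elements, so integrality of the
  pairing on the whole ring supplies the integers near
  \<open>\<alpha> * \<zeta> ^ n\<close>.\<close>

lemma M_set_if_trace_integral:
  assumes \<zeta>: "pisot \<zeta>" "rat_adjoin \<zeta> = K"
    and int: "\<And>u v. \<alpha> * elem u v + \<beta> * quad_conj (elem u v) \<in> \<int>"
  shows "\<alpha> \<in> M_set \<zeta>"
proof (rule M_setI)
  have \<zeta>K: "\<zeta> \<in> K - \<int>"
    using rat_adjoin_eq_K_iff \<zeta> by blast
  then obtain p q where pq: "\<zeta> = quad p q" by (auto elim: in_K_cases)
  have ai: "algebraic_int \<zeta>" using \<zeta> by (simp add: pisot_def)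
  have "q \<noteq> 0"
    using rational_algebraic_int_is_int[OF ai] \<zeta>K by (auto simp: pq quad_of_rat)
  then show "\<bar>quad_conj \<zeta>\<bar> < 1"
    using pisot_conj_less_1 \<zeta> pq by blast
  have "\<zeta> \<in> ring_of_integers K"
    using ai \<zeta>K by (simp add: ring_of_integers_def)
  then obtain a b where ab: "\<zeta> = elem a b"
    by (auto simp: ring_of_integers_K)
  have pow: "\<exists>u v. \<zeta> ^ n = elem u v \<and> quad_conj \<zeta> ^ n = quad_conj (elem u v)" for n
  proof (induction n)
    case 0
    have "elem 1 0 = 1" "quad_conj (elem 1 0) = 1"
      unfolding quad_conj_elem by (simp_all add: elem_def)
    then show ?case by (metis power_0)
  next
    case (Suc n)
    then obtain u v where "\<zeta> ^ n = elem u v" "quad_conj \<zeta> ^ n = quad_conj (elem u v)" by blast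
    then have "\<zeta> ^ Suc n = elem a b * elem u v" "quad_conj \<zeta> ^ Suc n = quad_conj (elem a b * elem u v)"
      by (simp_all add: ab quad_conj_mult)
    then show ?case unfolding elem_mult by blast
  qed
  show "\<alpha> * \<zeta> ^ n + \<beta> * quad_conj \<zeta> ^ n \<in> \<int>" for n
    using pow[of n] int by auto
qed

lemma inverse_sqrt_disc_in_M_set:
  assumes "pisot \<zeta>" "rat_adjoin \<zeta> = K"
  shows "1 / sqrt (of_int disc) \<in> M_set \<zeta>"
proof (rule M_set_if_trace_integral[OF assms])
  fix u v
  \<comment> \<open>\<open>omega\<close> minus its conjugate is sqrt D, so the integer part u
    cancels and v remains.\<close>
  have "1 / sqrt (of_int disc) * elem u v + - (1 / sqrt (of_int disc)) * quad_conj (elem u v) = of_int v"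
    unfolding quad_conj_elem using disc_ge by (simp add: elem_def omega_def field_simps)
  then show "1 / sqrt (of_int disc) * elem u v + - (1 / sqrt (of_int disc)) * quad_conj (elem u v) \<in> \<int>"
    by simp
qed

lemma ring_of_integers_subset_M_set:
  assumes "pisot \<zeta>" "rat_adjoin \<zeta> = K"
  shows "ring_of_integers K \<subseteq> M_set \<zeta>"
proof
  fix \<alpha> assume "\<alpha> \<in> ring_of_integers K"
  then obtain a b where \<alpha>: "\<alpha> = elem a b" by (auto simp: ring_of_integers_K)
  show "\<alpha> \<in> M_set \<zeta>"
  proof (rule M_set_if_trace_integral[OF assms])
    fix u v
    have "\<alpha> * elem u v + quad_conj \<alpha> * quad_conj (elem u v)
        = elem a b * elem u v + quad_conj (elem a b * elem u v)"
      by (simp add: \<alpha> quad_conj_mult)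
    then show "\<alpha> * elem u v + quad_conj \<alpha> * quad_conj (elem u v) \<in> \<int>"
      unfolding elem_mult elem_trace by simp
  qed
qed

lemma inverse_sqrt_disc_not_integral: "1 / sqrt (of_int disc) \<notin> ring_of_integers K"
proof
  let ?r = "sqrt (of_int disc)"
  assume "1 / ?r \<in> ring_of_integers K"
  then obtain u v where uv: "1 / ?r = elem u v" by (auto simp: ring_of_integers_K)
  have r: "?r * ?r = of_int disc" "?r \<noteq> 0"
    using disc_ge by simp_all
  have irr: "?r \<notin> \<rat>"
    \<comment> \<open>The two instances are the two values s and 2 s of sqrt D.\<close>
    using quad_irrational[of 1 0] quad_irrational[of 2 0] by (simp add: sqrt_disc quad_def)
  have "1 = elem u v * ?r"
    using r uv by (simp add: field_simps)
  also have "\<dots> = of_int u * ?r + of_int v * (of_int disc * ?r + ?r * ?r) / 2"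
    by (simp only: elem_def omega_def) (simp add: field_simps)
  finally have "2 = 2 * of_int u * ?r + of_int v * (of_int disc * ?r + of_int disc)"
    unfolding r by simp
  \<comment> \<open>Comparing rational parts gives v D = 2, which is impossible because D is at
    least 5.\<close>
  then have "of_rat (of_int (v * disc - 2)) + of_rat (of_int (2 * u + v * disc)) * ?r = 0"
    unfolding of_rat_of_int_eq by (simp add: algebra_simps)
  from linear_combination_irrational[OF irr this] have "v * disc - 2 = 0"
    by (simp only: of_int_eq_0_iff)
  then have "disc dvd 2" by (metis dvd_triv_right eq_iff_diff_eq_0)
  then show False using disc_ge zdvd_imp_le[of disc 2] by simp
qed

end

theorem theorem3p28:
  fixes d :: nat and K :: "real set"
  assumes "d > 1" and "squarefree d" and "K = rat_adjoin (sqrt (real d))"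
  shows "(\<forall>\<zeta>. pisot \<zeta> \<and> rat_adjoin \<zeta> = K \<longrightarrow>
             1 / sqrt (of_int (field_discriminant K)) \<in> M_set \<zeta>)
       \<and> (\<forall>\<zeta>. pisot \<zeta> \<longrightarrow> (rat_adjoin \<zeta> = K \<longleftrightarrow> \<zeta> \<in> K - \<int>))
       \<and> ring_of_integers K \<subset> (\<Inter>\<zeta>\<in>pisot_generators K. M_set \<zeta>)"
proof -
  interpret Q: real_quadratic_field d
    by unfold_locales (use assms in auto)
  have K: "K = Q.K"
    using assms(3) Q.rat_adjoin_sqrt by simp
  have in_M: "1 / sqrt (of_int (field_discriminant K)) \<in> M_set \<zeta>"
    if "pisot \<zeta>" "rat_adjoin \<zeta> = K" for \<zeta>
    using Q.inverse_sqrt_disc_in_M_set that by (simp add: K Q.field_discriminant_K)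
  moreover have "ring_of_integers K \<subset> (\<Inter>\<zeta>\<in>pisot_generators K. M_set \<zeta>)"
  proof (rule psubsetI)
    show "ring_of_integers K \<subseteq> (\<Inter>\<zeta>\<in>pisot_generators K. M_set \<zeta>)"
      using Q.ring_of_integers_subset_M_set by (auto simp: K pisot_generators_def)
    have "1 / sqrt (of_int (field_discriminant K)) \<in> (\<Inter>\<zeta>\<in>pisot_generators K. M_set \<zeta>)"
      using in_M by (auto simp: pisot_generators_def)
    then show "ring_of_integers K \<noteq> (\<Inter>\<zeta>\<in>pisot_generators K. M_set \<zeta>)"
      using Q.inverse_sqrt_disc_not_integral by (metis K Q.field_discriminant_K)
  qed
  ultimately show ?thesis
    using Q.rat_adjoin_eq_K_iff unfolding K by blast
qed

end
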